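(* If $\nu$ is discrete, then condition $(\mathcal{D})$ holds if and only if property $(\mathcal{R}_+)$ holds.
   Context: Setting: $\mathcal{Y}$ is a separable Banach space with Borel $\sigma$-algebra $\mathcal{B}(\mathcal{Y})$, and $\pi$ is a probability measure on $\mathbb{R}\times\mathcal{Y}$ (with its Borel $\sigma$-algebra) with first marginal $\mu$ on $\mathbb{R}$ and second marginal $\nu$ on $\mathcal{Y}$. Fix probability kernels $(\pi_{X=x})_{x\in\mathbb{R}}$ (probability measures on $\mathcal{Y}$) and $(\pi_{Y=y})_{y\in\mathcal{Y}}$ (probability measures on $\mathbb{R}$) disintegrating $\pi$: $\pi(dx,dy)=\mu(dx)\,\pi_{X=x}(dy)=\nu(dy)\,\pi_{Y=y}(dx)$. $D$ is the Borel set $D=\{y\in\mathcal{Y}:\pi_{Y=y}\text{ is a Dirac mass}\}$. $L^1_+(\mu)$ denotes the set of non-negative elements of $L^1(\mu)$. A probability measure is discrete if it is carried by an at most countable set. Condition $(\mathcal{D})$: $\pi_{X=x}(D)>0$ for $\mu$-a.e. $x$. Property $(\mathcal{R}_+)$: for every $f\in L^1_+(\mu)$ there exists a measurable $g:\mathcal{Y}\to\mathbb{R}_+=[0,\infty)$ such that $f(x)=\int_{\mathcal{Y}}g(y)\,\pi_{X=x}(dy)$ for $\mu$-a.e. $x$. *)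

theory Defs
  imports "HOL-Probability.Probability"
begin

definition disintegrates_along_fst ::
  "('a::topological_space \<times> 'b::topological_space) measure \<Rightarrow> 'a measure \<Rightarrow> ('a \<Rightarrow> 'b measure) \<Rightarrow> bool"
  where "disintegrates_along_fst \<pi> \<mu> K \<longleftrightarrow>
    K \<in> borel \<rightarrow>\<^sub>M prob_algebra borel \<and>
    (\<forall>C\<in>sets \<pi>. emeasure \<pi> C = (\<integral>\<^sup>+x. emeasure (K x) {y. (x, y) \<in> C} \<partial>\<mu>))"

definition disintegrates_along_snd ::
  "('a::topological_space \<times> 'b::topological_space) measure \<Rightarrow> 'b measure \<Rightarrow> ('b \<Rightarrow> 'a measure) \<Rightarrow> bool"
  where "disintegrates_along_snd \<pi> \<nu> L \<longleftrightarrow>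
    L \<in> borel \<rightarrow>\<^sub>M prob_algebra borel \<and>
    (\<forall>C\<in>sets \<pi>. emeasure \<pi> C = (\<integral>\<^sup>+y. emeasure (L y) {x. (x, y) \<in> C} \<partial>\<nu>))"

definition dirac_set :: "('b \<Rightarrow> 'a::topological_space measure) \<Rightarrow> 'b set"
  where "dirac_set L = {y. \<exists>a. L y = return borel a}"

text \<open>For a Borel kernel \<open>L\<close> of probability measures on the reals, \<open>dirac_set L\<close> is Borel: a
  probability measure on the reals is a Dirac mass iff its distribution function takes only the
  values \<open>0\<close> and \<open>1\<close> at rational points. So \<open>emeasure (K x) (dirac_set L)\<close> below is not the
  default value \<open>0\<close> for a non-measurable set.\<close>

definition condition_D ::
  "real measure \<Rightarrow> (real \<Rightarrow> 'b measure) \<Rightarrow> ('b \<Rightarrow> real measure) \<Rightarrow> bool"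
  where "condition_D \<mu> K L \<longleftrightarrow> (AE x in \<mu>. emeasure (K x) (dirac_set L) > 0)"

text \<open>Elements of \<open>L\<^sup>1\<^sub>+(\<mu>)\<close> are represented by integrable functions that are
  \<open>\<mu>\<close>-almost everywhere non-negative. The integral of \<open>g\<close> is taken in \<open>[0, \<infinity>]\<close>: the Bochner
  integral would silently be \<open>0\<close> for a non-integrable \<open>g\<close>.\<close>

definition property_R_plus ::
  "real measure \<Rightarrow> (real \<Rightarrow> 'b::topological_space measure) \<Rightarrow> bool"
  where "property_R_plus \<mu> K \<longleftrightarrow>
    (\<forall>f::real \<Rightarrow> real. integrable \<mu> f \<and> (AE x in \<mu>. 0 \<le> f x) \<longrightarrow>
      (\<exists>g::'b \<Rightarrow> real. g \<in> borel_measurable borel \<and> (\<forall>y. 0 \<le> g y) \<and>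
        (AE x in \<mu>. ennreal (f x) = (\<integral>\<^sup>+y. ennreal (g y) \<partial>K x))))"

definition discrete_measure :: "'a measure \<Rightarrow> bool"
  where "discrete_measure M \<longleftrightarrow> (\<exists>S. countable S \<and> (AE x in M. x \<in> S))"

end

theory Submission imports Defs begin

text \<open>Let \<open>S\<close> be a countable set carrying \<open>\<nu>\<close>, and write \<open>D\<close> for the set of \<open>y\<close> with \<open>L y\<close> Dirac.
  Evaluating \<open>\<pi> (A \<times> {y})\<close> in both ways shows that \<open>\<nu> {y} \<cdot> L y\<close> has \<open>\<mu>\<close>-density \<open>x \<mapsto> K x {y}\<close>.

  If (D) holds, for almost every \<open>x\<close> the points of \<open>D\<close> charged by \<open>K x\<close> satisfy \<open>L y = \<delta>\<^sub>x\<close>, so that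
  \<open>g y = f x / K x D\<close> for \<open>L y = \<delta>\<^sub>x\<close>, and \<open>g = 0\<close> off \<open>D \<inter> S\<close>, represents \<open>f\<close>.

  Conversely, suppose that \<open>N = {x. K x D = 0}\<close> has positive mass. Representing the indicator of
  a subset \<open>B\<close> of \<open>N\<close> with positive mass gives some \<open>y \<in> S - D\<close> with \<open>g y > 0\<close>; then \<open>K x {y} = 0\<close>
  for almost every \<open>x\<close> off \<open>B\<close>, so that \<open>L y\<close> is carried by \<open>B\<close>.
  Hence \<open>N\<close> contains no atom of \<open>\<mu>\<close>, and one can remove from \<open>N\<close>, for every \<open>y \<in> S\<close>, a
  small neighbourhood of a support point of \<open>L y\<close>, at a total cost of at most half of the mass
  of \<open>N\<close>. No \<open>L y\<close> is carried by what remains, a contradiction.\<close>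

section \<open>Support points and measurability of the set of Dirac fibres\<close>

lemma prob_space_kernel:
  assumes "K \<in> borel \<rightarrow>\<^sub>M prob_algebra borel"
  shows "prob_space (K x)" and "sets (K x) = sets borel"
proof -
  have "K x \<in> space (prob_algebra borel)"
    using measurable_space[OF assms] by simp
  then show "prob_space (K x)" "sets (K x) = sets borel"
    by (auto simp: space_prob_algebra)
qed

text \<open>Otherwise the null members of a countable basis would cover the space and make it
  null.\<close>

lemma prob_space_ex_support_point:
  fixes M :: "'a::second_countable_topology measure"
  assumes "prob_space M" and sets: "sets M = sets borel"
  shows "\<exists>a. \<forall>U. open U \<longrightarrow> a \<in> U \<longrightarrow> emeasure M U > 0"
proof (rule ccontr)
  interpret prob_space M by fact
  assume no: "\<not> ?thesis"
  obtain \<B> :: "'a set set" where \<B>: "countable \<B>" "topological_basis \<B>"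
    using ex_countable_basis by blast
  let ?N = "{B\<in>\<B>. emeasure M B = 0}"
  have "x \<in> \<Union>?N" for x
  proof -
    obtain U where "open U" "x \<in> U" "emeasure M U = 0"
      using no by (auto simp: not_gr_zero)
    moreover from this obtain B where "B \<in> \<B>" "x \<in> B" "B \<subseteq> U"
      using topological_basisE[OF \<B>(2)] by metis
    moreover have "emeasure M B \<le> emeasure M U"
      using \<open>B \<subseteq> U\<close> \<open>open U\<close> sets by (intro emeasure_mono) auto
    ultimately show ?thesis by auto
  qed
  then have "UNIV = (\<Union>B\<in>?N. B)" by auto
  moreover have "(\<Union>B\<in>?N. B) \<in> null_sets M"
    using \<B> sets
    by (intro null_sets_UN') (auto intro!: null_setsI borel_open topological_basis_open[OF \<B>(2)])
  ultimately have "emeasure M UNIV = 0" by (metis null_setsD1)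
  moreover have "space M = UNIV" using sets_eq_imp_space_eq[OF sets] by simp
  ultimately show False using emeasure_space_1 by simp
qed

text \<open>The basic sets around a support point have positive, hence full, measure; they are
  countably many and by the T1 axiom have only that point in common.\<close>

lemma prob_space_eq_return_iff_basis:
  fixes M :: "'a::{second_countable_topology, t1_space} measure"
  assumes "prob_space M" and sets: "sets M = sets borel"
    and \<B>: "countable \<B>" "topological_basis \<B>"
  shows "(\<exists>a. M = return borel a) \<longleftrightarrow> (\<forall>B\<in>\<B>. emeasure M B \<in> {0, 1})"
proof
  assume "\<exists>a. M = return borel a"
  then show "\<forall>B\<in>\<B>. emeasure M B \<in> {0, 1}"
    using \<B> by (auto simp: topological_basis_open indicator_def)
next
  interpret prob_space M by fact
  assume 01: "\<forall>B\<in>\<B>. emeasure M B \<in> {0, 1}"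
  obtain a where a: "\<And>U. open U \<Longrightarrow> a \<in> U \<Longrightarrow> emeasure M U > 0"
    using prob_space_ex_support_point[OF assms(1,2)] by blast
  have "AE x in M. x \<in> B" if "B \<in> {B\<in>\<B>. a \<in> B}" for B
  proof (rule AE_prob_1)
    have "emeasure M B = 1"
      using that 01 a[of B] topological_basis_open[OF \<B>(2)] by fastforce
    then show "prob B = 1" by (simp add: measure_def)
  qed
  then have "AE x in M. \<forall>B\<in>{B\<in>\<B>. a \<in> B}. x \<in> B"
    using \<B> by (subst AE_ball_countable) auto
  then have "AE x in M. x = a"
  proof (rule AE_mp, intro AE_I2 impI)
    fix x assume x: "\<forall>B\<in>{B\<in>\<B>. a \<in> B}. x \<in> B"
    show "x = a"
    proof (rule ccontr)
      assume "x \<noteq> a"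
      then obtain U where "open U" "a \<in> U" "x \<notin> U" using t1_space by metis
      moreover obtain B where "B \<in> \<B>" "a \<in> B" "B \<subseteq> U"
        using topological_basisE[OF \<B>(2) \<open>open U\<close> \<open>a \<in> U\<close>] .
      ultimately show False using x by blast
    qed
  qed
  then have "M = return M a" by (rule AE_eq_constD)
  also have "return M a = return borel a" using sets by (rule return_cong)
  finally show "\<exists>a. M = return borel a" ..
qed

text \<open>The criterion on a countable basis turns the set into a countable intersection of
  measurable conditions on \<open>y\<close>.\<close>

lemma sets_dirac_set:
  fixes L :: "'b::topological_space \<Rightarrow> 'a::{second_countable_topology, t1_space} measure"
  assumes L: "L \<in> borel \<rightarrow>\<^sub>M prob_algebra borel"
  shows "dirac_set L \<in> sets borel"
proof -
  obtain \<B> :: "'a set set" where \<B>: "countable \<B>" "topological_basis \<B>"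
    using ex_countable_basis by blast
  have "dirac_set L = (\<Inter>B\<in>\<B>. {y. emeasure (L y) B \<in> {0, 1}})"
    unfolding dirac_set_def
    using prob_space_eq_return_iff_basis[OF prob_space_kernel[OF L] \<B>] by auto
  also have "\<dots> = {y\<in>space borel. \<forall>B\<in>\<B>. emeasure (L y) B \<in> {0, 1}}" by auto
  also have "\<dots> \<in> sets borel"
  proof (rule sets.sets_Collect_countable_All'[OF _ \<B>(1)])
    fix B assume "B \<in> \<B>"
    then have "B \<in> sets borel" using \<B> by (simp add: topological_basis_open)
    then have "(\<lambda>y. emeasure (L y) B) \<in> borel_measurable borel"
      by (rule measurable_emeasure_kernel[OF measurable_prob_algebraD[OF L]])
    then show "{y \<in> space borel. emeasure (L y) B \<in> {0, 1}} \<in> sets borel"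
      by simp
  qed
  finally show ?thesis .
qed

section \<open>Sets of small mass charged by countably many probability measures\<close>

lemma ex_nbhd_small_measure:
  fixes M :: "'a::metric_space measure"
  assumes sets: "sets M = sets borel" and N: "N \<in> sets borel" and fin: "emeasure M N \<noteq> \<infinity>"
    and "emeasure M ({a} \<inter> N) = 0" and "e > 0"
  shows "\<exists>U. open U \<and> a \<in> U \<and> emeasure M (U \<inter> N) < e"
proof -
  let ?U = "\<lambda>n. ball a (inverse (real (Suc n)))"
  have "(\<Inter>n. ?U n) = {a}"
  proof safe
    fix x assume x: "x \<in> (\<Inter>n. ?U n)"
    show "x = a"
    proof (rule ccontr)
      assume "x \<noteq> a"
      then obtain n where "inverse (real (Suc n)) < dist a x"
        using reals_Archimedean[of "dist a x"] by auto
      with x show False by (auto simp: not_less dest!: spec[of _ n] INT_D[of _ _ _ n])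
    qed
  qed auto
  then have eq: "(\<Inter>n. ?U n \<inter> N) = {a} \<inter> N" by auto
  have "(\<lambda>n. emeasure M (?U n \<inter> N)) \<longlonglongrightarrow> emeasure M (\<Inter>n. ?U n \<inter> N)"
  proof (rule Lim_emeasure_decseq)
    show "range (\<lambda>n. ?U n \<inter> N) \<subseteq> sets M"
      unfolding sets by (intro image_subsetI sets.Int borel_open open_ball N)
    show "decseq (\<lambda>n. ?U n \<inter> N)"
      by (intro decseq_SucI Int_mono subset_ball order_refl le_imp_inverse_le) simp_all
    \<comment> \<open>Continuity from above requires finite measure; this is where
      \<open>fin\<close> enters.\<close>
    show "emeasure M (?U n \<inter> N) \<noteq> \<infinity>" for n
      using emeasure_mono[OF Int_lower2, of N M "?U n"] fin N sets by (metis infinity_ennreal_def neq_top_trans)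
  qed
  then have "(\<lambda>n. emeasure M (?U n \<inter> N)) \<longlonglongrightarrow> 0"
    using assms(4) by (simp only: eq)
  then have "eventually (\<lambda>n. emeasure M (?U n \<inter> N) < e) sequentially"
    using \<open>e > 0\<close> by (rule order_tendstoD)
  then obtain n where "emeasure M (?U n \<inter> N) < e"
    using eventually_happens'[OF sequentially_bot] by blast
  then show ?thesis by (intro exI[of _ "?U n"]) auto
qed

text \<open>\<open>C\<close> is a union of open neighbourhoods of support points, one for each
  \<open>P i\<close>. As \<open>N\<close> contains no atoms, each can be chosen with arbitrarily
  small mass inside \<open>N\<close>.\<close>

lemma ex_small_set_hitting:
  fixes M :: "'a::{metric_space, second_countable_topology} measure" and P :: "'i \<Rightarrow> 'a measure"
  assumes "finite_measure M" and sets: "sets M = sets borel" and N: "N \<in> sets borel" "emeasure M N > 0"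
    and no_atoms: "\<And>a. a \<in> N \<Longrightarrow> emeasure M {a} = 0"
    and I: "countable I"
    and P: "\<And>i. i \<in> I \<Longrightarrow> prob_space (P i)" "\<And>i. i \<in> I \<Longrightarrow> sets (P i) = sets borel"
  shows "\<exists>C\<in>sets borel. emeasure M (N - C) > 0 \<and> (\<forall>i\<in>I. emeasure (P i) C > 0)"
proof -
  interpret finite_measure M by fact
  define m where "m = measure M N"
  have m: "m > 0" "emeasure M N = ennreal m"
    using N(2) by (auto simp: m_def emeasure_eq_measure)
  \<comment> \<open>The budgets add up to \<open>m / 2\<close>, so at least half of the mass of
    \<open>N\<close> survives the removal.\<close>
  define e where "e n = m / 4 * (1 / 2) ^ n" for n :: nat
  have e_pos: "e n > 0" for n using m by (simp add: e_def)
  have e_sums: "e sums (m / 2)"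
    using sums_mult[OF geometric_sums[of "1 / 2 :: real"], of "m / 4"]
    by (simp add: e_def[abs_def])
  show ?thesis
  \<comment> \<open>The enumeration \<open>from_nat_into I\<close> stays in \<open>I\<close> only
    for nonempty \<open>I\<close>. For finite \<open>I\<close> it repeats elements, which is
    harmless since all \<open>e n\<close> are summed anyway.\<close>
  proof (cases "I = {}")
    case False
    have "\<exists>U. open U \<and> emeasure (P (from_nat_into I n)) U > 0 \<and> emeasure M (U \<inter> N) < ennreal (e n)" for n
    proof -
      have i: "from_nat_into I n \<in> I" using False by (rule from_nat_into)
      obtain a where a: "\<And>U. open U \<Longrightarrow> a \<in> U \<Longrightarrow> emeasure (P (from_nat_into I n)) U > 0"
        using prob_space_ex_support_point[OF P(1,2)[OF i]] by blast
      have "emeasure M ({a} \<inter> N) = 0" using no_atoms[of a] by (cases "a \<in> N") auto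
      then show ?thesis
        using ex_nbhd_small_measure[OF sets N(1), of a "ennreal (e n)"] a e_pos by auto
    qed
    then obtain U where U: "\<And>n. open (U n)" "\<And>n. emeasure (P (from_nat_into I n)) (U n) > 0"
        "\<And>n. emeasure M (U n \<inter> N) < ennreal (e n)"
      by metis
    let ?C = "\<Union>n. U n"
    have C: "?C \<in> sets borel" using U(1) by (intro borel_open) auto
    have "emeasure M (?C \<inter> N) = emeasure M (\<Union>n. U n \<inter> N)" by simp
    also have "\<dots> \<le> (\<Sum>n. emeasure M (U n \<inter> N))"
      using U(1) N sets by (intro emeasure_subadditive_countably) auto
    also have "\<dots> \<le> (\<Sum>n. ennreal (e n))"
      using U(3) by (intro suminf_le) (auto simp: less_imp_le)
    also have "\<dots> = ennreal (m / 2)"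
      using e_sums e_pos by (subst suminf_ennreal2) (auto simp: sums_iff less_imp_le)
    finally have "measure M (?C \<inter> N) \<le> m / 2" using m by (simp add: emeasure_eq_measure)
    moreover have "measure M (N - ?C) = m - measure M (?C \<inter> N)"
      using finite_measure_Diff'[of N ?C] N C sets by (simp add: m_def Int_commute)
    ultimately have "emeasure M (N - ?C) > 0" using m by (simp add: emeasure_eq_measure)
    moreover have "emeasure (P i) ?C > 0" if i: "i \<in> I" for i
    proof -
      have "0 < emeasure (P i) (U (to_nat_on I i))"
        using U(2)[of "to_nat_on I i"] from_nat_into_to_nat_on[OF I i] by simp
      also have "\<dots> \<le> emeasure (P i) ?C"
        using C P(2)[OF i] by (intro emeasure_mono) auto
      finally show ?thesis .
    qed
    ultimately show ?thesis using C by blast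
  qed (use N in \<open>auto intro!: bexI[of _ "{}"]\<close>)
qed

section \<open>Atoms and null sets under the two disintegrations\<close>

lemma AE_countable_singleton_nonnull:
  assumes S: "countable S" "\<And>y. y \<in> S \<Longrightarrow> {y} \<in> sets M" and "AE y in M. y \<in> S"
  shows "AE y in M. y \<in> S \<and> emeasure M {y} \<noteq> 0"
proof -
  \<comment> \<open>Quantifying over fixed points \<open>z\<close> of \<open>S\<close> leaves
    countably many null sets to discard.\<close>
  have "AE y in M. \<forall>z\<in>S. emeasure M {z} = 0 \<longrightarrow> y \<noteq> z"
  proof (subst AE_ball_countable[OF S(1)], intro ballI)
    fix z assume "z \<in> S"
    show "AE y in M. emeasure M {z} = 0 \<longrightarrow> y \<noteq> z"
    proof (cases "emeasure M {z} = 0")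
      case True
      then have "{z} \<in> null_sets M" using S(2)[OF \<open>z \<in> S\<close>] by (intro null_setsI)
      from AE_not_in[OF this] show ?thesis by auto
    qed auto
  qed
  with assms(3) show ?thesis by eventually_elim auto
qed

text \<open>The only link between the two kernels: both are evaluated on
  \<open>A \<times> {y}\<close>.\<close>

lemma disintegration_singleton:
  fixes \<pi> :: "('a::second_countable_topology \<times> 'b::{second_countable_topology, t1_space}) measure"
  assumes \<pi>: "sets \<pi> = sets borel" and \<nu>: "sets \<nu> = sets borel"
    and K: "disintegrates_along_fst \<pi> \<mu> K" and L: "disintegrates_along_snd \<pi> \<nu> L"
    and A: "A \<in> sets borel"
  shows "(\<integral>\<^sup>+x. emeasure (K x) {y} * indicator A x \<partial>\<mu>) = emeasure (L y) A * emeasure \<nu> {y}"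
proof -
  have C: "A \<times> {y} \<in> sets \<pi>" unfolding \<pi> using A by (intro borel_Times) auto
  have "(\<integral>\<^sup>+x. emeasure (K x) {y} * indicator A x \<partial>\<mu>)
      = (\<integral>\<^sup>+x. emeasure (K x) {z. (x, z) \<in> A \<times> {y}} \<partial>\<mu>)"
    by (intro nn_integral_cong) (auto simp: indicator_def)
  also have "\<dots> = emeasure \<pi> (A \<times> {y})" using K C by (simp add: disintegrates_along_fst_def)
  also have "\<dots> = (\<integral>\<^sup>+z. emeasure (L z) {x. (x, z) \<in> A \<times> {y}} \<partial>\<nu>)"
    using L C by (simp add: disintegrates_along_snd_def)
  also have "\<dots> = (\<integral>\<^sup>+z. emeasure (L y) A * indicator {y} z \<partial>\<nu>)"
    by (intro nn_integral_cong) (auto simp: indicator_def)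
  also have "\<dots> = emeasure (L y) A * emeasure \<nu> {y}" using \<nu> by (simp add: nn_integral_cmult_indicator)
  finally show ?thesis .
qed

text \<open>The cylinder over the complement of \<open>S\<close> is null for \<open>\<pi>\<close>,
  so the non-negative function \<open>x \<mapsto> K x (-S)\<close> has integral zero.\<close>

lemma disintegration_AE_snd:
  fixes \<pi> :: "('a::second_countable_topology \<times> 'b::second_countable_topology) measure"
  assumes \<pi>: "sets \<pi> = sets borel" and \<mu>: "sets \<mu> = sets borel"
    and K: "disintegrates_along_fst \<pi> \<mu> K"
    and S: "S \<in> sets borel" "AE y in distr \<pi> borel snd. y \<in> S"
  shows "AE x in \<mu>. AE y in K x. y \<in> S"
proof -
  have K_meas: "K \<in> borel \<rightarrow>\<^sub>M prob_algebra borel" using K by (simp add: disintegrates_along_fst_def)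
  have snd: "snd \<in> \<pi> \<rightarrow>\<^sub>M borel"
    unfolding measurable_cong_sets[OF \<pi> refl] by (intro borel_measurable_continuous_onI continuous_intros)
  have C: "UNIV \<times> -S \<in> sets \<pi>" unfolding \<pi> using S by (intro borel_Times) auto
  have "emeasure \<pi> (UNIV \<times> -S) = emeasure (distr \<pi> borel snd) (-S)"
    using S(1) snd sets_eq_imp_space_eq[OF \<pi>]
    by (subst emeasure_distr) (auto intro!: arg_cong[where f = "emeasure \<pi>"])
  also have "\<dots> = 0"
    using emeasure_eq_0_AE[OF eventually_mono[OF S(2)], of "\<lambda>y. y \<in> -S"] by (simp add: Compl_eq)
  finally have "(\<integral>\<^sup>+x. emeasure (K x) (-S) \<partial>\<mu>) = 0"
    using K C by (simp add: disintegrates_along_fst_def Compl_eq)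
  moreover have "(\<lambda>x. emeasure (K x) (-S)) \<in> borel_measurable \<mu>"
    unfolding measurable_cong_sets[OF \<mu> refl]
    using S by (intro measurable_emeasure_kernel[OF measurable_prob_algebraD[OF K_meas]]) auto
  ultimately have "AE x in \<mu>. emeasure (K x) (-S) = 0" by (simp add: nn_integral_0_iff_AE)
  then show ?thesis
  proof eventually_elim
    case (elim x)
    then have "-S \<in> null_sets (K x)"
      using S by (intro null_setsI) (auto simp: prob_space_kernel(2)[OF K_meas])
    from AE_not_in[OF this] show ?case by simp
  qed
qed

section \<open>Disintegrations with a fixed countable carrier of the second marginal\<close>

locale discrete_disintegration =
  fixes \<pi> :: "('a::{metric_space, second_countable_topology} \<times> 'b::{metric_space, second_countable_topology}) measure"
    and \<mu> :: "'a measure" and \<nu> :: "'b measure"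
    and K :: "'a \<Rightarrow> 'b measure" and L :: "'b \<Rightarrow> 'a measure" and S :: "'b set"
  assumes prob_\<pi>: "prob_space \<pi>" and sets_\<pi>: "sets \<pi> = sets borel"
    and \<mu>_eq: "\<mu> = distr \<pi> borel fst" and \<nu>_eq: "\<nu> = distr \<pi> borel snd"
    and K: "disintegrates_along_fst \<pi> \<mu> K" and L: "disintegrates_along_snd \<pi> \<nu> L"
    and countable_S: "countable S" and AE_S: "AE y in \<nu>. y \<in> S"
begin

lemma K_meas: "K \<in> borel \<rightarrow>\<^sub>M prob_algebra borel"
  using K by (simp add: disintegrates_along_fst_def)

lemma L_meas: "L \<in> borel \<rightarrow>\<^sub>M prob_algebra borel"
  using L by (simp add: disintegrates_along_snd_def)

lemmas prob_K = prob_space_kernel(1)[OF K_meas] and sets_K = prob_space_kernel(2)[OF K_meas]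
lemmas prob_L = prob_space_kernel(1)[OF L_meas] and sets_L = prob_space_kernel(2)[OF L_meas]

lemma sets_\<mu>: "sets \<mu> = sets borel" and sets_\<nu>: "sets \<nu> = sets borel"
  by (simp_all add: \<mu>_eq \<nu>_eq)

lemma prob_\<mu>: "prob_space \<mu>"
  unfolding \<mu>_eq
proof (rule prob_space.prob_space_distr[OF prob_\<pi>])
  show "fst \<in> \<pi> \<rightarrow>\<^sub>M borel"
    unfolding measurable_cong_sets[OF sets_\<pi> refl]
    by (intro borel_measurable_continuous_onI continuous_intros)
qed

lemma sets_D: "dirac_set L \<in> sets borel"
  by (rule sets_dirac_set[OF L_meas])

lemma measurable_emeasure_K: "A \<in> sets borel \<Longrightarrow> (\<lambda>x. emeasure (K x) A) \<in> borel_measurable \<mu>"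
  unfolding measurable_cong_sets[OF sets_\<mu> refl]
  by (rule measurable_emeasure_kernel[OF measurable_prob_algebraD[OF K_meas]])

text \<open>A non-negative integral vanishes iff its integrand does almost everywhere. This trades
  statements on the atoms of \<open>K x\<close> for statements on \<open>L y\<close>.\<close>

lemma singleton_null_iff:
  assumes "A \<in> sets borel"
  shows "(AE x in \<mu>. x \<in> A \<longrightarrow> emeasure (K x) {y} = 0) \<longleftrightarrow> emeasure (L y) A = 0 \<or> emeasure \<nu> {y} = 0"
proof -
  have "(\<lambda>x. emeasure (K x) {y} * indicator A x) \<in> borel_measurable \<mu>"
    using assms sets_\<mu> by (intro borel_measurable_times_ennreal measurable_emeasure_K) auto
  then have "(AE x in \<mu>. emeasure (K x) {y} * indicator A x = 0)
      \<longleftrightarrow> emeasure (L y) A * emeasure \<nu> {y} = 0"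
    by (simp only: nn_integral_0_iff_AE[symmetric]
        disintegration_singleton[OF sets_\<pi> sets_\<nu> K L assms])
  moreover have "emeasure (K x) {y} * indicator A x = 0 \<longleftrightarrow> (x \<in> A \<longrightarrow> emeasure (K x) {y} = 0)" for x
    by (auto simp: indicator_def)
  ultimately show ?thesis by (simp only: mult_eq_0_iff)
qed

lemma AE_K_atoms: "AE x in \<mu>. AE y in K x. y \<in> S \<and> emeasure (K x) {y} \<noteq> 0"
proof -
  have "S \<in> sets borel"
    by (rule sets.countable[OF _ countable_S]) auto
  then have "AE x in \<mu>. AE y in K x. y \<in> S"
    using AE_S unfolding \<nu>_eq by (rule disintegration_AE_snd[OF sets_\<pi> sets_\<mu> K])
  then show ?thesis
    by eventually_elim (rule AE_countable_singleton_nonnull[OF countable_S], auto simp: sets_K)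
qed

text \<open>A Dirac mass at \<open>a\<close> does not charge \<open>-{a}\<close>, so almost every
  \<open>x\<close> other than \<open>a\<close> has \<open>K x {y} = 0\<close>; countability of
  \<open>S\<close> merges the exceptional sets.\<close>

lemma AE_dirac_point:
  "AE x in \<mu>. \<forall>y\<in>S. \<forall>a. L y = return borel a \<longrightarrow> emeasure (K x) {y} \<noteq> 0 \<longrightarrow> x = a"
proof (subst AE_ball_countable[OF countable_S], intro ballI)
  fix y assume "y \<in> S"
  show "AE x in \<mu>. \<forall>a. L y = return borel a \<longrightarrow> emeasure (K x) {y} \<noteq> 0 \<longrightarrow> x = a"
  proof (cases "y \<in> dirac_set L")
    case True
    then obtain a where a: "L y = return borel a" by (auto simp: dirac_set_def)
    then have "emeasure (L y) (-{a}) = 0" by simp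
    then have "AE x in \<mu>. x \<in> -{a} \<longrightarrow> emeasure (K x) {y} = 0"
      by (subst singleton_null_iff) auto
    then show ?thesis
    proof eventually_elim
      case (elim x)
      \<comment> \<open>The Dirac point is unique, as the mass of \<open>{a}\<close> shows.\<close>
      have "b = a" if "L y = return borel b" for b
      proof -
        have "emeasure (return borel b) {a} = emeasure (return borel a) {a}" using a that by simp
        then show ?thesis by (simp add: indicator_def split: if_splits)
      qed
      with elim show ?case by auto
    qed
  qed (auto simp: dirac_set_def)
qed

section \<open>From positive mass on Dirac fibres to representation\<close>

lemma representation:
  fixes f :: "'a \<Rightarrow> real"
  assumes D: "AE x in \<mu>. emeasure (K x) (dirac_set L) > 0" and f: "AE x in \<mu>. 0 \<le> f x"
  shows "\<exists>g::'b \<Rightarrow> real. g \<in> borel_measurable borel \<and> (\<forall>y. 0 \<le> g y) \<and>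
        (AE x in \<mu>. ennreal (f x) = (\<integral>\<^sup>+y. ennreal (g y) \<partial>K x))"
proof -
  define a where "a y = (SOME a. L y = return borel a)" for y
  have a: "L y = return borel (a y)" if "y \<in> dirac_set L" for y
    using that unfolding dirac_set_def a_def by (auto intro: someI)
  \<comment> \<open>The maximum makes \<open>g\<close> non-negative at every point although
    \<open>f\<close> is so only almost everywhere. Division by zero gives \<open>0\<close>, on a
    null set of \<open>x\<close> by \<open>D\<close>.\<close>
  define c where "c x = max 0 (f x) / measure (K x) (dirac_set L)" for x
  define g where "g y = (if y \<in> dirac_set L \<inter> S then c (a y) else 0)" for y
  have "g \<in> borel_measurable borel"
  \<comment> \<open>\<open>g\<close> differs from zero only on the countable set \<open>S\<close>,
    so the arbitrary choice in \<open>a\<close> does not affect measurability.\<close>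
  proof (rule measurable_discrete_difference[where f = "\<lambda>_. 0" and X = S])
  qed (use countable_S in \<open>auto simp: g_def\<close>)
  moreover have "0 \<le> g y" for y by (simp add: g_def c_def)
  moreover have "AE x in \<mu>. ennreal (f x) = (\<integral>\<^sup>+y. ennreal (g y) \<partial>K x)"
    using D f AE_K_atoms AE_dirac_point
  proof eventually_elim
    case (elim x)
    interpret prob_space "K x" by (rule prob_K)
    \<comment> \<open>Almost all Dirac fibres seen by \<open>K x\<close> sit at \<open>x\<close>
      itself, so \<open>g\<close> takes there the constant value \<open>c x\<close>.\<close>
    have "(\<integral>\<^sup>+y. ennreal (g y) \<partial>K x) = (\<integral>\<^sup>+y. ennreal (c x) * indicator (dirac_set L) y \<partial>K x)"
    proof (rule nn_integral_cong_AE)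
      show "AE y in K x. ennreal (g y) = ennreal (c x) * indicator (dirac_set L) y"
        using elim(3)
      proof eventually_elim
        case (elim y)
        show ?case
        proof (cases "y \<in> dirac_set L")
          case True
          then have "x = a y" using \<open>\<forall>y\<in>S. _ y\<close> elim a by blast
          then show ?thesis using elim True by (simp add: g_def)
        qed (simp add: g_def)
      qed
    qed
    also have "\<dots> = ennreal (c x * measure (K x) (dirac_set L))"
      using sets_D by (simp add: nn_integral_cmult_indicator sets_K emeasure_eq_measure c_def flip: ennreal_mult)
    also have "c x * measure (K x) (dirac_set L) = f x"
      using elim(1,2) by (simp add: c_def emeasure_eq_measure)
    finally show ?case by simp
  qed
  ultimately show ?thesis by blast
qed

section \<open>From representation to positive mass on Dirac fibres\<close>

lemma represented_indicator_carries:
  fixes g :: "'b \<Rightarrow> real"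
  assumes B: "B \<in> sets borel" "emeasure \<mu> B > 0" "\<And>x. x \<in> B \<Longrightarrow> emeasure (K x) (dirac_set L) = 0"
    and g: "AE x in \<mu>. indicator B x = (\<integral>\<^sup>+y. ennreal (g y) \<partial>K x)"
  shows "\<exists>y\<in>S - dirac_set L. emeasure (L y) (- B) = 0"
proof -
  \<comment> \<open>At the end this rules out the alternative \<open>emeasure \<nu> {y} = 0\<close>
    offered by \<open>singleton_null_iff\<close>.\<close>
  have "AE x in \<mu>. \<forall>y\<in>S. emeasure \<nu> {y} = 0 \<longrightarrow> emeasure (K x) {y} = 0"
  proof (subst AE_ball_countable[OF countable_S], intro ballI)
    fix y
    show "AE x in \<mu>. emeasure \<nu> {y} = 0 \<longrightarrow> emeasure (K x) {y} = 0"
      using singleton_null_iff[of UNIV y] by (cases "emeasure \<nu> {y} = 0") auto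
  qed
  with g AE_K_atoms have "AE x in \<mu>. indicator B x = (\<integral>\<^sup>+y. ennreal (g y) \<partial>K x) \<and>
      (AE y in K x. y \<in> S \<and> emeasure (K x) {y} \<noteq> 0) \<and>
      (\<forall>y\<in>S. emeasure \<nu> {y} = 0 \<longrightarrow> emeasure (K x) {y} = 0)" (is "AE x in \<mu>. ?P x")
    by eventually_elim blast
  moreover have "\<not> (AE x in \<mu>. x \<notin> B)"
    using B(1,2) AE_iff_null_sets[of B \<mu>] sets_\<mu> by auto
  \<comment> \<open>Since \<open>B\<close> is not null, the almost sure properties hold together at
    some single point of \<open>B\<close>.\<close>
  ultimately have "\<exists>x\<in>B. ?P x"
    using eventually_mono[of ?P "ae_filter \<mu>" "\<lambda>x. x \<notin> B"] by blast
  then obtain x where "x \<in> B" and P: "?P x" by blast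
  then have x: "x \<in> B" "1 = (\<integral>\<^sup>+y. ennreal (g y) \<partial>K x)"
      "AE y in K x. y \<in> S \<and> emeasure (K x) {y} \<noteq> 0"
      "\<And>y. y \<in> S \<Longrightarrow> emeasure \<nu> {y} = 0 \<Longrightarrow> emeasure (K x) {y} = 0"
    by simp_all
  have "\<exists>y\<in>S - dirac_set L. emeasure (K x) {y} \<noteq> 0 \<and> ennreal (g y) \<noteq> 0"
  proof (rule ccontr)
    assume none: "\<not> ?thesis"
    have "dirac_set L \<in> null_sets (K x)"
      using B(3)[OF x(1)] sets_D sets_K by (intro null_setsI) auto
    from AE_not_in[OF this] x(3) have "AE y in K x. ennreal (g y) = 0"
      by eventually_elim (use none in auto)
    then have "(\<integral>\<^sup>+y. ennreal (g y) \<partial>K x) = (\<integral>\<^sup>+y. 0 \<partial>K x)" by (rule nn_integral_cong_AE)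
    with x(2) show False by simp
  qed
  then obtain y where y: "y \<in> S - dirac_set L" "emeasure (K x) {y} \<noteq> 0" "ennreal (g y) \<noteq> 0" by blast
  have "AE x in \<mu>. x \<in> - B \<longrightarrow> emeasure (K x) {y} = 0"
    using g
  proof eventually_elim
    case (elim x')
    \<comment> \<open>The contribution of one point is bounded by the whole integral, which is zero
      off \<open>B\<close>; as \<open>g y\<close> is positive, \<open>K x'\<close> cannot charge
      \<open>y\<close>.\<close>
    have "ennreal (g y) * emeasure (K x') {y} = (\<integral>\<^sup>+z. ennreal (g y) * indicator {y} z \<partial>K x')"
      by (simp add: nn_integral_cmult_indicator sets_K)
    also have "\<dots> \<le> (\<integral>\<^sup>+z. ennreal (g z) \<partial>K x')"
      by (intro nn_integral_mono) (auto simp: indicator_def)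
    also have "\<dots> = indicator B x'" by (rule elim[symmetric])
    finally show ?case using y(3) by (auto simp: indicator_def split: if_splits)
  qed
  then have "emeasure (L y) (- B) = 0 \<or> emeasure \<nu> {y} = 0"
    using B(1) by (subst (asm) singleton_null_iff) auto
  with x(4)[of y] y show ?thesis by blast
qed

text \<open>The representation of indicators is applied to two kinds of subsets of \<open>N\<close>:
  single atoms, which are thereby excluded, and then \<open>N - C\<close>.\<close>

lemma AE_dirac_set_pos:
  assumes "\<And>B. B \<in> sets borel \<Longrightarrow>
    \<exists>g::'b \<Rightarrow> real. AE x in \<mu>. indicator B x = (\<integral>\<^sup>+y. ennreal (g y) \<partial>K x)"
  shows "AE x in \<mu>. emeasure (K x) (dirac_set L) > 0"
proof (rule ccontr)
  assume not_AE: "\<not> ?thesis"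
  define N where "N = {x. emeasure (K x) (dirac_set L) = 0}"
  have "{x\<in>space \<mu>. emeasure (K x) (dirac_set L) = 0} \<in> sets \<mu>"
    using measurable_emeasure_K[OF sets_D] by simp
  then have N: "N \<in> sets borel"
    using sets_\<mu> sets_eq_imp_space_eq[OF sets_\<mu>] by (simp add: N_def)
  have "N \<notin> null_sets \<mu>"
    using not_AE AE_not_in[of N \<mu>] by (auto simp: N_def not_gr_zero zero_less_iff_neq_zero)
  then have N_pos: "emeasure \<mu> N > 0"
    using N sets_\<mu> by (auto simp: null_sets_def zero_less_iff_neq_zero)
  have carries: "\<exists>y\<in>S - dirac_set L. emeasure (L y) (- B) = 0"
    if "B \<in> sets borel" "emeasure \<mu> B > 0" "B \<subseteq> N" for B
    using assms[OF that(1)] represented_indicator_carries[OF that(1,2)] that(3)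
    by (auto simp: N_def)
  \<comment> \<open>With \<open>B = {a}\<close> some \<open>L y\<close> outside the Dirac set would
    be carried by one point, hence Dirac.\<close>
  have no_atoms: "emeasure \<mu> {a} = 0" if a: "a \<in> N" for a
  proof (rule ccontr)
    assume "emeasure \<mu> {a} \<noteq> 0"
    then obtain y where y: "y \<notin> dirac_set L" "emeasure (L y) (- {a}) = 0"
      using carries[of "{a}"] a by (auto simp: zero_less_iff_neq_zero)
    interpret prob_space "L y" by (rule prob_L)
    have "- {a} \<in> null_sets (L y)" using y(2) by (intro null_setsI) (auto simp: sets_L)
    from AE_not_in[OF this] have "AE x in L y. x = a" by simp
    then have "L y = return (L y) a" by (rule AE_eq_constD)
    also have "\<dots> = return borel a" by (rule return_cong[OF sets_L])
    finally show False using y(1) by (auto simp: dirac_set_def)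
  qed
  obtain C where C: "C \<in> sets borel" "emeasure \<mu> (N - C) > 0" "\<And>y. y \<in> S \<Longrightarrow> emeasure (L y) C > 0"
    using ex_small_set_hitting[where P = L, OF _ sets_\<mu> N N_pos no_atoms countable_S prob_L sets_L]
      prob_space.finite_measure[OF prob_\<mu>] by auto
  obtain y where y: "y \<in> S" "emeasure (L y) (- (N - C)) = 0"
    using carries[of "N - C"] N C by auto
  \<comment> \<open>\<open>C\<close> lies in the complement of \<open>N - C\<close>, which is null
    for this \<open>L y\<close>, yet every \<open>L y\<close> with \<open>y\<close> in
    \<open>S\<close> charges \<open>C\<close>.\<close>
  have "emeasure (L y) C \<le> emeasure (L y) (- (N - C))"
    using N C(1) by (intro emeasure_mono) (auto simp: sets_L)
  with y C(3) show False by fastforce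
qed

end

theorem corollary2p11:
  fixes \<pi> :: "(real \<times> 'b::{banach, second_countable_topology}) measure"
    and \<mu> :: "real measure"
    and \<nu> :: "'b measure"
    and K :: "real \<Rightarrow> 'b measure"
    and L :: "'b \<Rightarrow> real measure"
  assumes "prob_space \<pi>"
    and "sets \<pi> = sets borel"
    and "\<mu> = distr \<pi> borel fst"
    and "\<nu> = distr \<pi> borel snd"
    and "disintegrates_along_fst \<pi> \<mu> K"
    and "disintegrates_along_snd \<pi> \<nu> L"
    and "discrete_measure \<nu>"
  shows "condition_D \<mu> K L \<longleftrightarrow> property_R_plus \<mu> K"
proof -
  obtain S where S: "countable S" "AE y in \<nu>. y \<in> S"
    using assms(7) by (auto simp: discrete_measure_def)
  interpret discrete_disintegration \<pi> \<mu> \<nu> K L S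
    using assms(1-6) S by (rule discrete_disintegration.intro)
  show ?thesis
  proof
    assume "condition_D \<mu> K L"
    then show "property_R_plus \<mu> K"
      unfolding condition_D_def property_R_plus_def using representation by blast
  next
    assume R: "property_R_plus \<mu> K"
    interpret prob_space \<mu> by (rule prob_\<mu>)
    have "\<exists>g::'b \<Rightarrow> real. AE x in \<mu>. indicator B x = (\<integral>\<^sup>+y. ennreal (g y) \<partial>K x)"
      if "B \<in> sets borel" for B
    proof -
      \<comment> \<open>Finiteness of \<open>\<mu>\<close> makes indicators of Borel sets admissible
        choices of \<open>f\<close>.\<close>
      have "integrable \<mu> (indicator B :: real \<Rightarrow> real)"
        using that sets_\<mu> by (intro integrable_real_indicator) (auto simp: emeasure_eq_measure)
      then obtain g :: "'b \<Rightarrow> real"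
        where "AE x in \<mu>. ennreal (indicator B x) = (\<integral>\<^sup>+y. ennreal (g y) \<partial>K x)"
        using R[unfolded property_R_plus_def, rule_format, of "indicator B"] by auto
      then show ?thesis by (auto simp: ennreal_indicator)
    qed
    then show "condition_D \<mu> K L"
      unfolding condition_D_def by (rule AE_dirac_set_pos)
  qed
qed

end
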